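(* Let $\varepsilon>0$ and $\alpha\in(0,\frac12]$. Assume that real functions $B$ and $b$ on $\Omega_\varepsilon$ satisfy the following three conditions: (1) $B$ is locally concave on $\Omega_\varepsilon$ and $b$ is locally convex on $\Omega_\varepsilon$. (2) $B$ and $b$ have non-tangential derivatives at every point of $\Gamma_\varepsilon$. Furthermore, for any two distinct points $P=(p,p^2+\varepsilon^2)$ and $Q=(q,q^2+\varepsilon^2)$ on $\Gamma_\varepsilon$ with $|p-q|\le\frac{1-\alpha}{\sqrt\alpha}\,\varepsilon$, $$ (D_{\overrightarrow{PQ}}B)(P)\ge (D_{\overrightarrow{PQ}}B)(Q),\qquad (D_{\overrightarrow{PQ}}b)(P)\le (D_{\overrightarrow{PQ}}b)(Q), $$ where $D_{\overrightarrow{PQ}}$ denotes the derivative in the direction of the vector $\overrightarrow{PQ}$. (3) For any two distinct points $P=(p,p^2+\varepsilon^2)$ and $Q=(q,q^2+\varepsilon^2)$ on $\Gamma_\varepsilon$ with $|p-q|\le\frac{1-\alpha}{\sqrt\alpha}\,\varepsilon$, and $S=\frac1{1-\alpha}(P-\alpha Q)$, $$ B(P)\ge (1-\alpha)\, B(S)+\alpha\, B(Q),\qquad b(P)\le (1-\alpha)\, b(S)+\alpha\, b(Q). $$ Then $B$ is $\alpha$-concave on $\Omega_\varepsilon$ and $b$ is $\alpha$-convex on $\Omega_\varepsilon$.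
   Context: $\Omega_\varepsilon=\{x=(x_1,x_2)\in\mathbb{R}^2:\ x_1^2\le x_2\le x_1^2+\varepsilon^2\}$ and $\Gamma_\varepsilon=\{x:\ x_2=x_1^2+\varepsilon^2\}$ is its upper boundary curve. A function on $\Omega_\varepsilon$ is locally concave (respectively, locally convex) if it is concave (respectively, convex) on every convex subset of $\Omega_\varepsilon$. A function $B$ on $\Omega_\varepsilon$ is $\alpha$-concave if $B(\beta x^-+(1-\beta)x^+)\ge\beta B(x^-)+(1-\beta)B(x^+)$ for every $\beta\in[\alpha,\frac12]$ and any two points $x^\pm\in\Omega_\varepsilon$ such that $\beta x^-+(1-\beta)x^+\in\Omega_\varepsilon$. A function $b$ on $\Omega_\varepsilon$ is $\alpha$-convex if the reverse inequality holds for all such $\beta,x^-,x^+$. Derivatives at points of $\Gamma_\varepsilon$: since the open segment between $P$ and $Q$ lies outside $\Omega_\varepsilon$, the directional derivatives are one-sided, taken along the part of the line through $P$ and $Q$ lying in $\Omega_\varepsilon$ near the point: with $v=\overrightarrow{PQ}=Q-P$, $(D_{\overrightarrow{PQ}}B)(P)=\lim_{t\to0^-}\frac{B(P+tv)-B(P)}{t}$ and $(D_{\overrightarrow{PQ}}B)(Q)=\lim_{t\to0^+}\frac{B(Q+tv)-B(Q)}{t}$, and similarly for $b$. Having non-tangential derivatives at a point of $\Gamma_\varepsilon$ means that such (finite) one-sided derivatives exist along every line through that point not tangent to $\Gamma_\varepsilon$. *)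

theory Defs
  imports "HOL-Analysis.Analysis"
begin

definition Omega :: "real \<Rightarrow> (real \<times> real) set" where
  "Omega \<epsilon> = {x. (fst x)\<^sup>2 \<le> snd x \<and> snd x \<le> (fst x)\<^sup>2 + \<epsilon>\<^sup>2}"

definition Gamma_up :: "real \<Rightarrow> (real \<times> real) set" where
  "Gamma_up \<epsilon> = {x. snd x = (fst x)\<^sup>2 + \<epsilon>\<^sup>2}"

text \<open>Functions on the strip are modelled as total functions on the plane; all notions below
  use only their values on the strip.\<close>

definition locally_concave_on :: "(real \<times> real) set \<Rightarrow> (real \<times> real \<Rightarrow> real) \<Rightarrow> bool" where
  "locally_concave_on D F \<longleftrightarrow> (\<forall>C. C \<subseteq> D \<and> convex C \<longrightarrow> concave_on C F)"

definition locally_convex_on :: "(real \<times> real) set \<Rightarrow> (real \<times> real \<Rightarrow> real) \<Rightarrow> bool" where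
  "locally_convex_on D F \<longleftrightarrow> (\<forall>C. C \<subseteq> D \<and> convex C \<longrightarrow> convex_on C F)"

definition alpha_concave :: "real \<Rightarrow> real \<Rightarrow> (real \<times> real \<Rightarrow> real) \<Rightarrow> bool" where
  "alpha_concave \<alpha> \<epsilon> F \<longleftrightarrow>
    (\<forall>\<beta>\<in>{\<alpha>..1/2}. \<forall>x\<in>Omega \<epsilon>. \<forall>y\<in>Omega \<epsilon>.
       \<beta> *\<^sub>R x + (1 - \<beta>) *\<^sub>R y \<in> Omega \<epsilon> \<longrightarrow>
       F (\<beta> *\<^sub>R x + (1 - \<beta>) *\<^sub>R y) \<ge> \<beta> * F x + (1 - \<beta>) * F y)"

definition alpha_convex :: "real \<Rightarrow> real \<Rightarrow> (real \<times> real \<Rightarrow> real) \<Rightarrow> bool" where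
  "alpha_convex \<alpha> \<epsilon> F \<longleftrightarrow>
    (\<forall>\<beta>\<in>{\<alpha>..1/2}. \<forall>x\<in>Omega \<epsilon>. \<forall>y\<in>Omega \<epsilon>.
       \<beta> *\<^sub>R x + (1 - \<beta>) *\<^sub>R y \<in> Omega \<epsilon> \<longrightarrow>
       F (\<beta> *\<^sub>R x + (1 - \<beta>) *\<^sub>R y) \<le> \<beta> * F x + (1 - \<beta>) * F y)"

text \<open>The parameter \<open>t\<close> tends to 0 along the part of the line that lies in the strip. At a point
  of the upper boundary, for \<open>v\<close> not tangent, this is a one-sided limit: \<open>t\<close> tends to 0 from the left
  if \<open>v\<close> points out of the strip and from the right if it points into it (see the lemmas below).\<close>

definition strip_filter :: "real \<Rightarrow> real \<times> real \<Rightarrow> real \<times> real \<Rightarrow> real filter" where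
  "strip_filter \<epsilon> x v = at 0 within {t. x + t *\<^sub>R v \<in> Omega \<epsilon>}"

definition has_dir_deriv ::
    "real \<Rightarrow> (real \<times> real \<Rightarrow> real) \<Rightarrow> real \<times> real \<Rightarrow> real \<times> real \<Rightarrow> real \<Rightarrow> bool" where
  "has_dir_deriv \<epsilon> F v x d \<longleftrightarrow>
    ((\<lambda>t. (F (x + t *\<^sub>R v) - F x) / t) \<longlongrightarrow> d) (strip_filter \<epsilon> x v)"

definition dir_deriv ::
    "real \<Rightarrow> (real \<times> real \<Rightarrow> real) \<Rightarrow> real \<times> real \<Rightarrow> real \<times> real \<Rightarrow> real" where
  "dir_deriv \<epsilon> F v x = Lim (strip_filter \<epsilon> x v) (\<lambda>t. (F (x + t *\<^sub>R v) - F x) / t)"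

text \<open>The tangent direction to the upper boundary at \<open>x\<close> is \<open>(1, 2 * fst x)\<close>, so \<open>v\<close> is
  non-zero and not tangent iff \<open>snd v \<noteq> 2 * fst x * fst v\<close>.\<close>

definition nontangential_derivs_at ::
    "real \<Rightarrow> (real \<times> real \<Rightarrow> real) \<Rightarrow> real \<times> real \<Rightarrow> bool" where
  "nontangential_derivs_at \<epsilon> F x \<longleftrightarrow>
    (\<forall>v. snd v \<noteq> 2 * fst x * fst v \<longrightarrow> (\<exists>d. has_dir_deriv \<epsilon> F v x d))"

lemma strip_near_boundary_point:
  assumes "\<epsilon> > 0" "x \<in> Gamma_up \<epsilon>" "snd v \<noteq> 2 * fst x * fst v"
  obtains S where "open S" "0 \<in> S"
    "\<And>t. t \<in> S \<Longrightarrow> t \<noteq> 0 \<Longrightarrow>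
       x + t *\<^sub>R v \<in> Omega \<epsilon> \<longleftrightarrow> t * (snd v - 2 * fst x * fst v) < 0"
proof -
  define c where "c = snd v - 2 * fst x * fst v"
  have c: "c \<noteq> 0" using assms by (simp add: c_def)
  have iff: "x + t *\<^sub>R v \<in> Omega \<epsilon> \<longleftrightarrow>
      t\<^sup>2 * (fst v)\<^sup>2 - t * c \<le> \<epsilon>\<^sup>2 \<and> t * c \<le> t\<^sup>2 * (fst v)\<^sup>2" for t
    using assms(2) unfolding Omega_def Gamma_up_def c_def
    by (auto simp: power2_eq_square algebra_simps)
  have "((\<lambda>t. t\<^sup>2 * (fst v)\<^sup>2 - t * c) \<longlongrightarrow> 0\<^sup>2 * (fst v)\<^sup>2 - 0 * c) (nhds 0)"
    by (intro tendsto_intros filterlim_ident)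
  then have e1: "\<forall>\<^sub>F t in nhds 0. t\<^sup>2 * (fst v)\<^sup>2 - t * c < \<epsilon>\<^sup>2"
    using assms(1) by (intro order_tendstoD) auto
  have "((\<lambda>t. \<bar>t\<bar> * (fst v)\<^sup>2) \<longlongrightarrow> \<bar>0\<bar> * (fst v)\<^sup>2) (nhds 0)"
    by (intro tendsto_intros filterlim_ident)
  then have e2: "\<forall>\<^sub>F t in nhds 0. \<bar>t\<bar> * (fst v)\<^sup>2 < \<bar>c\<bar>"
    using c by (intro order_tendstoD) auto
  obtain S where S: "open S" "0 \<in> S"
    "\<And>t. t \<in> S \<Longrightarrow> t\<^sup>2 * (fst v)\<^sup>2 - t * c < \<epsilon>\<^sup>2 \<and> \<bar>t\<bar> * (fst v)\<^sup>2 < \<bar>c\<bar>"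
    using eventually_conj[OF e1 e2] unfolding eventually_nhds by blast
  have "x + t *\<^sub>R v \<in> Omega \<epsilon> \<longleftrightarrow> t * c < 0" if "t \<in> S" "t \<noteq> 0" for t
  proof (cases "t * c < 0")
    case True
    moreover have "0 \<le> t\<^sup>2 * (fst v)\<^sup>2" by simp
    ultimately have "t * c \<le> t\<^sup>2 * (fst v)\<^sup>2" by linarith
    then show ?thesis using True S(3)[OF that(1)] iff[of t] by simp
  next
    case False
    have "\<bar>t\<bar> * (\<bar>t\<bar> * (fst v)\<^sup>2) < \<bar>t\<bar> * \<bar>c\<bar>"
      using S(3)[OF that(1)] that(2) by (intro mult_strict_left_mono) auto
    also have "\<dots> = t * c" using False by (simp flip: abs_mult)
    finally have "(\<bar>t\<bar> * \<bar>t\<bar>) * (fst v)\<^sup>2 < t * c" by (simp only: mult.assoc)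
    then have "t\<^sup>2 * (fst v)\<^sup>2 < t * c" by (simp add: power2_eq_square)
    then show ?thesis using False iff[of t] by simp
  qed
  with S(1,2) show ?thesis using that unfolding c_def by blast
qed

lemma strip_filter_outward:
  assumes "\<epsilon> > 0" "x \<in> Gamma_up \<epsilon>" "snd v > 2 * fst x * fst v"
  shows "strip_filter \<epsilon> x v = at_left 0"
proof -
  obtain S where S: "open S" "0 \<in> S"
    "\<And>t. t \<in> S \<Longrightarrow> t \<noteq> 0 \<Longrightarrow>
       x + t *\<^sub>R v \<in> Omega \<epsilon> \<longleftrightarrow> t * (snd v - 2 * fst x * fst v) < 0"
    using strip_near_boundary_point[OF assms(1,2), of v] assms(3) by auto
  have "t * (snd v - 2 * fst x * fst v) < 0 \<longleftrightarrow> t < 0" for t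
    using assms(3) by (auto simp: mult_less_0_iff)
  with S(3) show ?thesis
    unfolding strip_filter_def by (intro at_within_nhd[OF S(2,1)]) auto
qed

lemma strip_filter_inward:
  assumes "\<epsilon> > 0" "x \<in> Gamma_up \<epsilon>" "snd v < 2 * fst x * fst v"
  shows "strip_filter \<epsilon> x v = at_right 0"
proof -
  obtain S where S: "open S" "0 \<in> S"
    "\<And>t. t \<in> S \<Longrightarrow> t \<noteq> 0 \<Longrightarrow>
       x + t *\<^sub>R v \<in> Omega \<epsilon> \<longleftrightarrow> t * (snd v - 2 * fst x * fst v) < 0"
    using strip_near_boundary_point[OF assms(1,2), of v] assms(3) by auto
  have "t * (snd v - 2 * fst x * fst v) < 0 \<longleftrightarrow> t > 0" for t
    using assms(3) by (auto simp: mult_less_0_iff)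
  with S(3) show ?thesis
    unfolding strip_filter_def by (intro at_within_nhd[OF S(2,1)]) auto
qed

lemma dir_deriv_secant:
  assumes "\<epsilon> > 0" "P \<in> Gamma_up \<epsilon>" "Q \<in> Gamma_up \<epsilon>" "P \<noteq> Q"
  shows "dir_deriv \<epsilon> F (Q - P) P = Lim (at_left 0) (\<lambda>t. (F (P + t *\<^sub>R (Q - P)) - F P) / t)"
    and "dir_deriv \<epsilon> F (Q - P) Q = Lim (at_right 0) (\<lambda>t. (F (Q + t *\<^sub>R (Q - P)) - F Q) / t)"
proof -
  have "fst P \<noteq> fst Q" using assms unfolding Gamma_up_def by (auto simp: prod_eq_iff)
  then have "(fst Q - fst P)\<^sup>2 > 0" by simp
  then have "snd (Q - P) > 2 * fst P * fst (Q - P)" "snd (Q - P) < 2 * fst Q * fst (Q - P)"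
    using assms(2,3) unfolding Gamma_up_def by (auto simp: power2_eq_square algebra_simps)
  then show "dir_deriv \<epsilon> F (Q - P) P = Lim (at_left 0) (\<lambda>t. (F (P + t *\<^sub>R (Q - P)) - F P) / t)"
    and "dir_deriv \<epsilon> F (Q - P) Q = Lim (at_right 0) (\<lambda>t. (F (Q + t *\<^sub>R (Q - P)) - F Q) / t)"
    using assms by (simp_all add: dir_deriv_def strip_filter_outward strip_filter_inward)
qed

end

theory Submission
  imports Defs
begin

text \<open>If the segment from \<open>x\<close> to \<open>y\<close> leaves the strip, it does so through a secant \<open>PQ\<close> of the
  upper parabola. Say the intermediate point lies on the side of \<open>P\<close>, which is also the side of
  \<open>x\<close>. The weight at \<open>y\<close> being at least \<open>\<alpha>\<close> forces \<open>S\<close> to lie between \<open>x\<close> and \<open>P\<close>, so \<open>S\<close> is in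
  the strip and \<open>P\<close>, \<open>Q\<close> are close enough for both hypotheses to apply. The slope \<open>\<tau>\<close> of \<open>B\<close> from
  \<open>x\<close> to \<open>P\<close> then bounds the slope from \<open>P\<close> to \<open>Q\<close> (by the inequality for \<open>S\<close>, \<open>P\<close>, \<open>Q\<close>) and the
  slope from \<open>Q\<close> to \<open>y\<close> (by the comparison of derivatives), so \<open>B\<close> lies below the line of slope
  \<open>\<tau>\<close> through \<open>P\<close> at \<open>y\<close>, and above it between \<open>x\<close> and \<open>P\<close>.\<close>

section \<open>Concave functions of one variable on either side of a gap\<close>

lemma concave_on_real_chord:
  fixes f :: "real \<Rightarrow> real"
  assumes "concave_on {l..r} f" and "l \<le> t" "t \<le> r" "l < r"
  shows "(r - l) * f t \<ge> (r - t) * f l + (t - l) * f r"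
proof -
  define w where "w = (t - l) / (r - l)"
  have w: "0 \<le> w" "w \<le> 1" using assms by (auto simp: w_def)
  have "w * (r - l) = t - l" using assms by (simp add: w_def)
  then have t: "t = (1 - w) * l + w * r" by (simp add: algebra_simps)
  have "f ((1 - w) *\<^sub>R l + w *\<^sub>R r) \<ge> (1 - w) * f l + w * f r"
    using concave_onD[OF assms(1) w] assms by simp
  then have "(r - l) * f t \<ge> (r - l) * ((1 - w) * f l + w * f r)"
    using assms t by (intro mult_left_mono) auto
  moreover have "(r - l) * w = t - l" "(r - l) * (1 - w) = r - t"
    using assms by (simp_all add: w_def field_simps)
  ultimately show ?thesis by (metis distrib_left mult.assoc)
qed

text \<open>The points \<open>0\<close>, \<open>1\<close> and \<open>- \<alpha> / (1 - \<alpha>)\<close> are the parameters of \<open>P\<close>, \<open>Q\<close> and \<open>S\<close> on the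
  secant \<open>P + t *\<^sub>R (Q - P)\<close>.\<close>

lemma chord_below_across_gap:
  fixes f :: "real \<Rightarrow> real"
  assumes \<alpha>: "0 < \<alpha>" "\<alpha> < 1" and u: "\<alpha> \<le> u" "u \<le> 1"
    and ad: "a \<le> 0" "1 \<le> d" and left: "(1 - u) * a + u * d \<le> 0"
    and conc: "concave_on {a..0} f" "concave_on {1..d} f"
    and k: "((\<lambda>t. (f t - f 0) / t) \<longlongrightarrow> k) (at_left 0)"
    and k': "((\<lambda>t. (f (1 + t) - f 1) / t) \<longlongrightarrow> k') (at_right 0)"
    and kk: "k' \<le> k"
    and jump: "f 0 \<ge> (1 - \<alpha>) * f (- (\<alpha> / (1 - \<alpha>))) + \<alpha> * f 1"
  shows "f ((1 - u) * a + u * d) \<ge> (1 - u) * f a + u * f d"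
proof -
  define S where "S = - (\<alpha> / (1 - \<alpha>))"
  have S\<alpha>: "(1 - \<alpha>) * S = - \<alpha>" using \<alpha> by (simp add: S_def)
  \<comment> \<open>Since \<open>a\<close> is nonpositive, the combination is smallest for
    \<open>u = \<alpha>\<close> and \<open>d = 1\<close>. With \<open>left\<close> this gives
    \<open>(1 - \<alpha>) * a \<le> - \<alpha>\<close>, which is exactly
    \<open>a \<le> S\<close>.\<close>
  have "(1 - \<alpha>) * a + \<alpha> \<le> (1 - u) * a + u * d"
  proof -
    have "(u - \<alpha>) * a \<le> 0" "u * 1 \<le> u * d" using u ad \<alpha>
      by (auto simp: mult_nonneg_nonpos intro!: mult_left_mono)
    then show ?thesis using u by (simp add: algebra_simps)
  qed
  with left S\<alpha> have "(1 - \<alpha>) * a \<le> (1 - \<alpha>) * S" by linarith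
  then have aS: "a \<le> S" using \<alpha> by simp
  have S0: "S < 0" using \<alpha> by (simp add: S_def)
  with aS have a0: "a < 0" by simp
  define \<tau> where "\<tau> = (f a - f 0) / a"
  have fa: "f a = f 0 + \<tau> * a" using a0 by (simp add: \<tau>_def)
  have above: "f t \<ge> f 0 + \<tau> * t" if "a \<le> t" "t \<le> 0" for t
  proof -
    have "(0 - a) * f t \<ge> (0 - t) * f a + (t - a) * f 0"
      using concave_on_real_chord[OF conc(1) that a0] .
    then have "(- a) * (f 0 + \<tau> * t) \<le> (- a) * f t" by (simp add: fa algebra_simps)
    then show ?thesis using a0 by (simp only: mult_le_cancel_left_pos)
  qed
  \<comment> \<open>For negative \<open>t\<close>, dividing \<open>above\<close> by \<open>t\<close>
    reverses it, so every left difference quotient close to 0 is at most \<open>\<tau>\<close>, and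
    so is the limit.\<close>
  have "k \<le> \<tau>"
  proof (rule tendsto_upperbound[OF k])
    have "\<forall>\<^sub>F t in at_left 0. t \<in> {a<..<0}" by (rule eventually_at_left_real[OF a0])
    then show "\<forall>\<^sub>F t in at_left 0. (f t - f 0) / t \<le> \<tau>"
    proof eventually_elim
      case (elim t)
      then show ?case using above[of t] by (simp add: divide_le_eq)
    qed
  qed simp
  \<comment> \<open>By concavity on \<open>{1..d}\<close> the difference quotients at 1 dominate the
    slope of the whole chord, hence so does their limit \<open>k'\<close>.\<close>
  have "f d - f 1 \<le> k' * (d - 1)"
  proof (cases "d = 1")
    case False
    with ad have d: "1 < d" by simp
    have "(f d - f 1) / (d - 1) \<le> k'"
    proof (rule tendsto_lowerbound[OF k'])
      have "\<forall>\<^sub>F t in at_right 0. t \<in> {0<..<d - 1}"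
        using d by (intro eventually_at_right_real) simp
      then show "\<forall>\<^sub>F t in at_right 0. (f d - f 1) / (d - 1) \<le> (f (1 + t) - f 1) / t"
      proof eventually_elim
        case (elim t)
        then have "(d - 1) * f (1 + t) \<ge> (d - (1 + t)) * f 1 + ((1 + t) - 1) * f d"
          using d by (intro concave_on_real_chord[OF conc(2)]) auto
        then have "(f d - f 1) * t \<le> (f (1 + t) - f 1) * (d - 1)" by (simp add: algebra_simps)
        then show ?case using elim d by (simp add: field_simps)
      qed
    qed simp
    then show ?thesis using d by (simp add: divide_le_eq)
  qed simp
  also have "\<dots> \<le> \<tau> * (d - 1)"
    using \<open>k \<le> \<tau>\<close> kk ad by (intro mult_right_mono) auto
  finally have fd1: "f d \<le> f 1 + \<tau> * (d - 1)" by simp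
  \<comment> \<open>Since \<open>0 = (1 - \<alpha>) * S + \<alpha> * 1\<close>, the lower bound for
    \<open>f S\<close> turns \<open>jump\<close> into an upper bound for \<open>f 1\<close>: the
    slope across the gap is at most \<open>\<tau>\<close>.\<close>
  have "(1 - \<alpha>) * (f 0 + \<tau> * S) \<le> (1 - \<alpha>) * f S"
    using above[OF aS] S0 \<alpha> by (intro mult_left_mono) auto
  moreover have "(1 - \<alpha>) * (f 0 + \<tau> * S) = (1 - \<alpha>) * f 0 - \<tau> * \<alpha>"
    by (simp add: distrib_left mult.left_commute[of "1 - \<alpha>" \<tau>] S\<alpha>)
  ultimately have "\<alpha> * f 1 \<le> \<alpha> * (f 0 + \<tau>)"
    using jump by (simp add: S_def algebra_simps)
  then have "f 1 \<le> f 0 + \<tau>" using \<alpha> by simp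
  with fd1 have fd: "f d \<le> f 0 + \<tau> * d" by (simp add: algebra_simps)
  have "(1 - u) * f a + u * f d \<le> (1 - u) * (f 0 + \<tau> * a) + u * (f 0 + \<tau> * d)"
    using fa fd u \<alpha> by (intro add_mono mult_left_mono) auto
  also have "\<dots> = f 0 + \<tau> * ((1 - u) * a + u * d)" by (simp add: algebra_simps)
  also have "\<dots> \<le> f ((1 - u) * a + u * d)"
  proof (rule above[OF _ left])
    have "0 \<le> u * (d - a)" using u \<alpha> ad by simp
    then show "a \<le> (1 - u) * a + u * d" by (simp add: algebra_simps)
  qed
  finally show ?thesis .
qed

section \<open>Secants of the upper parabola: their part in the strip and derivatives along
  them\<close>

lemma secant_in_Omega_iff:
  assumes "P \<in> Gamma_up \<epsilon>" "Q \<in> Gamma_up \<epsilon>"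
  shows "P + t *\<^sub>R (Q - P) \<in> Omega \<epsilon> \<longleftrightarrow>
    0 \<le> (fst P - fst Q)\<^sup>2 * (t * (t - 1)) \<and> (fst P - fst Q)\<^sup>2 * (t * (t - 1)) \<le> \<epsilon>\<^sup>2"
proof -
  \<comment> \<open>The height over the lower parabola is quadratic in \<open>t\<close>, with value
    \<open>\<epsilon>\<^sup>2\<close> at \<open>t = 0\<close> and \<open>t = 1\<close>; it exceeds
    \<open>\<epsilon>\<^sup>2\<close> exactly between these two parameters.\<close>
  have "snd (P + t *\<^sub>R (Q - P)) - (fst (P + t *\<^sub>R (Q - P)))\<^sup>2
      = \<epsilon>\<^sup>2 - (fst P - fst Q)\<^sup>2 * (t * (t - 1))"
    using assms by (simp add: Gamma_up_def power2_eq_square algebra_simps)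
  then show ?thesis by (auto simp: Omega_def)
qed

lemma Gamma_up_fst_neq:
  assumes "P \<in> Gamma_up \<epsilon>" "Q \<in> Gamma_up \<epsilon>" "P \<noteq> Q"
  shows "fst P \<noteq> fst Q"
  using assms by (auto simp: Gamma_up_def prod_eq_iff)

text \<open>Moving the parameter from \<open>s\<close> towards the gap between 0 and 1 decreases
  \<open>t * (t - 1)\<close> but keeps it nonnegative, so neither boundary is crossed.\<close>

lemma secant_interval_in_Omega:
  assumes "P \<in> Gamma_up \<epsilon>" "Q \<in> Gamma_up \<epsilon>"
    and "P + s *\<^sub>R (Q - P) \<in> Omega \<epsilon>"
    and "s \<le> t \<and> t \<le> 0 \<or> 1 \<le> t \<and> t \<le> s"
  shows "P + t *\<^sub>R (Q - P) \<in> Omega \<epsilon>"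
proof -
  have "0 \<le> t * (t - 1)" using assms(4) by (auto simp: zero_le_mult_iff)
  moreover have "t * (t - 1) \<le> s * (s - 1)"
  proof -
    have "0 \<le> (s - t) * (s + t - 1)" using assms(4) by (auto simp: zero_le_mult_iff)
    then show ?thesis by (simp add: algebra_simps)
  qed
  then have "(fst P - fst Q)\<^sup>2 * (t * (t - 1)) \<le> (fst P - fst Q)\<^sup>2 * (s * (s - 1))"
    by (intro mult_left_mono) auto
  ultimately show ?thesis using assms(3) secant_in_Omega_iff[OF assms(1,2)] by fastforce
qed

lemma locally_concave_on_line:
  assumes "locally_concave_on D F" and "\<And>t. t \<in> {l..r} \<Longrightarrow> x + t *\<^sub>R v \<in> D"
  shows "concave_on {l..r} (\<lambda>t. F (x + t *\<^sub>R v))"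
proof -
  define g where "g t = x + t *\<^sub>R v" for t
  have g: "g ((1 - w) * s + w * t) = (1 - w) *\<^sub>R g s + w *\<^sub>R g t" for w s t
    by (simp add: g_def algebra_simps)
  have "convex ((\<lambda>y. x + y) ` (\<lambda>t. t *\<^sub>R v) ` {l..r})"
    by (intro convex_translation convex_linear_image linear_scaleR_left) simp
  then have "convex (g ` {l..r})" by (simp add: g_def image_image)
  moreover have "g ` {l..r} \<subseteq> D" using assms(2) by (auto simp: g_def)
  ultimately have conc: "concave_on (g ` {l..r}) F"
    using assms(1) unfolding locally_concave_on_def by blast
  have "concave_on {l..r} (\<lambda>t. F (g t))"
  proof (rule concave_on_linorderI)
    fix w s t :: real
    assume "0 < w" "w < 1" "s \<in> {l..r}" "t \<in> {l..r}"
    then show "F (g ((1 - w) *\<^sub>R s + w *\<^sub>R t)) \<ge> (1 - w) * F (g s) + w * F (g t)"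
      using concave_onD[OF conc, of w "g s" "g t"] by (simp add: g)
  qed simp
  then show ?thesis by (simp add: g_def)
qed

text \<open>A secant of a parabola is not tangent at its endpoints: the deviation of
  \<open>snd (Q - P)\<close> from the tangent value is \<open>(fst Q - fst P)\<^sup>2\<close> at
  \<open>P\<close> and its negative at \<open>Q\<close>. So the hypothesis yields limits, and
  \<open>dir_deriv\<close>, a mere \<open>Lim\<close>, is equal to them.\<close>

lemma secant_derivs:
  assumes "\<epsilon> > 0" "P \<in> Gamma_up \<epsilon>" "Q \<in> Gamma_up \<epsilon>" "P \<noteq> Q"
    and "\<forall>x\<in>Gamma_up \<epsilon>. nontangential_derivs_at \<epsilon> F x"
  shows "has_dir_deriv \<epsilon> F (Q - P) P (dir_deriv \<epsilon> F (Q - P) P)"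
    and "has_dir_deriv \<epsilon> F (Q - P) Q (dir_deriv \<epsilon> F (Q - P) Q)"
    and "strip_filter \<epsilon> P (Q - P) = at_left 0" "strip_filter \<epsilon> Q (Q - P) = at_right 0"
proof -
  have "(fst Q - fst P)\<^sup>2 > 0" using Gamma_up_fst_neq[OF assms(2-4)] by simp
  then have nt: "snd (Q - P) > 2 * fst P * fst (Q - P)" "snd (Q - P) < 2 * fst Q * fst (Q - P)"
    using assms(2,3) unfolding Gamma_up_def by (auto simp: power2_eq_square algebra_simps)
  show fl: "strip_filter \<epsilon> P (Q - P) = at_left 0" "strip_filter \<epsilon> Q (Q - P) = at_right 0"
    using strip_filter_outward strip_filter_inward nt assms by auto
  obtain d where d: "has_dir_deriv \<epsilon> F (Q - P) P d"
    using nt(1) assms(2,5) unfolding nontangential_derivs_at_def by (metis less_irrefl)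
  obtain e where e: "has_dir_deriv \<epsilon> F (Q - P) Q e"
    using nt(2) assms(3,5) unfolding nontangential_derivs_at_def by (metis less_irrefl)
  have "dir_deriv \<epsilon> F (Q - P) P = d" "dir_deriv \<epsilon> F (Q - P) Q = e"
    using d e unfolding dir_deriv_def has_dir_deriv_def fl by (auto intro!: tendsto_Lim)
  with d e show "has_dir_deriv \<epsilon> F (Q - P) P (dir_deriv \<epsilon> F (Q - P) P)"
    "has_dir_deriv \<epsilon> F (Q - P) Q (dir_deriv \<epsilon> F (Q - P) Q)" by simp_all
qed

section \<open>Transfer of the one-variable inequality to the strip\<close>

lemma concave_across_secant:
  assumes "\<epsilon> > 0" and \<alpha>: "0 < \<alpha>" "\<alpha> < 1"
    and conc: "locally_concave_on (Omega \<epsilon>) F"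
    and nt: "\<forall>x\<in>Gamma_up \<epsilon>. nontangential_derivs_at \<epsilon> F x"
    and deriv: "\<And>P Q. P \<in> Gamma_up \<epsilon> \<Longrightarrow> Q \<in> Gamma_up \<epsilon> \<Longrightarrow> P \<noteq> Q \<Longrightarrow>
           \<bar>fst P - fst Q\<bar> \<le> (1 - \<alpha>) / sqrt \<alpha> * \<epsilon> \<Longrightarrow>
           dir_deriv \<epsilon> F (Q - P) P \<ge> dir_deriv \<epsilon> F (Q - P) Q"
    and jump: "\<And>P Q. P \<in> Gamma_up \<epsilon> \<Longrightarrow> Q \<in> Gamma_up \<epsilon> \<Longrightarrow> P \<noteq> Q \<Longrightarrow>
           \<bar>fst P - fst Q\<bar> \<le> (1 - \<alpha>) / sqrt \<alpha> * \<epsilon> \<Longrightarrow>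
           F P \<ge> (1 - \<alpha>) * F ((1 / (1 - \<alpha>)) *\<^sub>R (P - \<alpha> *\<^sub>R Q)) + \<alpha> * F Q"
    and P: "P \<in> Gamma_up \<epsilon>" and Q: "Q \<in> Gamma_up \<epsilon>" and PQ: "P \<noteq> Q"
    and x: "x = P + a *\<^sub>R (Q - P)" "x \<in> Omega \<epsilon>" "a \<le> 0"
    and y: "y = P + d *\<^sub>R (Q - P)" "y \<in> Omega \<epsilon>" "1 \<le> d"
    and u: "\<alpha> \<le> u" "u \<le> 1" and left: "(1 - u) * a + u * d \<le> 0"
  shows "F ((1 - u) *\<^sub>R x + u *\<^sub>R y) \<ge> (1 - u) * F x + u * F y"
proof -
  define f where "f t = F (P + t *\<^sub>R (Q - P))" for t
  define S where "S = - (\<alpha> / (1 - \<alpha>))"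
  have "(1 - \<alpha>) * a + \<alpha> \<le> (1 - u) * a + u * d"
  proof -
    have "(u - \<alpha>) * a \<le> 0" "u * 1 \<le> u * d" using u x(3) y(3) \<alpha>
      by (auto simp: mult_nonneg_nonpos intro!: mult_left_mono)
    then show ?thesis using u by (simp add: algebra_simps)
  qed
  then have "a \<le> S" using left \<alpha> by (simp add: S_def field_simps)
  moreover have "S \<le> 0" using \<alpha> by (simp add: S_def)
  ultimately have "P + S *\<^sub>R (Q - P) \<in> Omega \<epsilon>"
    using \<open>S \<le> 0\<close> by (intro secant_interval_in_Omega[OF P Q x(2)[unfolded x(1)]]) simp
  \<comment> \<open>The distance bound in the hypotheses is the condition that \<open>S\<close> does
    not drop below the lower parabola, because
    \<open>S * (S - 1) = \<alpha> / (1 - \<alpha>)\<^sup>2\<close>.\<close>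
  then have "(fst P - fst Q)\<^sup>2 * (S * (S - 1)) \<le> \<epsilon>\<^sup>2"
    using secant_in_Omega_iff[OF P Q] by blast
  moreover have "S * (S - 1) = \<alpha> / (1 - \<alpha>)\<^sup>2"
    using \<alpha> by (simp add: S_def field_simps power2_eq_square)
  ultimately have "(fst P - fst Q)\<^sup>2 \<le> (1 - \<alpha>)\<^sup>2 / \<alpha> * \<epsilon>\<^sup>2"
    using \<alpha> by (simp add: field_simps)
  also have "\<dots> = ((1 - \<alpha>) / sqrt \<alpha> * \<epsilon>)\<^sup>2"
    using \<alpha> by (simp add: power_mult_distrib power_divide)
  finally have "(fst P - fst Q)\<^sup>2 \<le> ((1 - \<alpha>) / sqrt \<alpha> * \<epsilon>)\<^sup>2" .
  then have close: "\<bar>fst P - fst Q\<bar> \<le> (1 - \<alpha>) / sqrt \<alpha> * \<epsilon>"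
    using \<alpha> \<open>\<epsilon> > 0\<close> power2_le_imp_le[of "\<bar>fst P - fst Q\<bar>"] by simp
  have "P + S *\<^sub>R (Q - P) = (1 / (1 - \<alpha>)) *\<^sub>R (P - \<alpha> *\<^sub>R Q)"
    using \<alpha> by (simp add: S_def prod_eq_iff field_simps)
  then have "f 0 \<ge> (1 - \<alpha>) * f S + \<alpha> * f 1"
    using jump[OF P Q PQ close] by (simp add: f_def)
  moreover have "concave_on {a..0} f" "concave_on {1..d} f"
    unfolding f_def
    by (rule locally_concave_on_line[OF conc],
        rule secant_interval_in_Omega[OF P Q x(2)[unfolded x(1)]], simp,
        rule locally_concave_on_line[OF conc],
        rule secant_interval_in_Omega[OF P Q y(2)[unfolded y(1)]], simp)
  moreover have "((\<lambda>t. (f t - f 0) / t) \<longlongrightarrow> dir_deriv \<epsilon> F (Q - P) P) (at_left 0)"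
    "((\<lambda>t. (f (1 + t) - f 1) / t) \<longlongrightarrow> dir_deriv \<epsilon> F (Q - P) Q) (at_right 0)"
    using secant_derivs[OF \<open>\<epsilon> > 0\<close> P Q PQ nt]
    unfolding has_dir_deriv_def f_def by (simp_all add: algebra_simps)
  ultimately have "f ((1 - u) * a + u * d) \<ge> (1 - u) * f a + u * f d"
    using deriv[OF P Q PQ close] \<alpha> u x(3) y(3) left
    by (intro chord_below_across_gap[where \<alpha> = \<alpha> and k = "dir_deriv \<epsilon> F (Q - P) P"
          and k' = "dir_deriv \<epsilon> F (Q - P) Q"]) (auto simp: S_def)
  moreover have "(1 - u) *\<^sub>R x + u *\<^sub>R y = P + ((1 - u) * a + u * d) *\<^sub>R (Q - P)"
    unfolding x(1) y(1) by (simp add: algebra_simps)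
  ultimately show ?thesis by (simp add: f_def flip: x(1) y(1))
qed

text \<open>The region above the lower parabola is convex, so a segment can leave the strip only
  through the upper one. The height \<open>h\<close> over the upper parabola is then positive
  somewhere but not at the ends, and a zero on each side gives \<open>P\<close> and
  \<open>Q\<close>.\<close>

lemma segment_in_Omega_or_secant:
  assumes x: "x \<in> Omega \<epsilon>" and y: "y \<in> Omega \<epsilon>"
  obtains "closed_segment x y \<subseteq> Omega \<epsilon>"
    | P Q a d where "P \<in> Gamma_up \<epsilon>" "Q \<in> Gamma_up \<epsilon>" "P \<noteq> Q"
      "x = P + a *\<^sub>R (Q - P)" "a \<le> 0" "y = P + d *\<^sub>R (Q - P)" "1 \<le> d"
proof (cases "closed_segment x y \<subseteq> Omega \<epsilon>")
  case False
  define g where "g t = x + t *\<^sub>R (y - x)" for t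
  define h where "h t = snd (g t) - (fst (g t))\<^sup>2 - \<epsilon>\<^sup>2" for t
  obtain w where w: "0 \<le> w" "w \<le> 1" "g w \<notin> Omega \<epsilon>"
  proof -
    obtain z where z: "z \<in> closed_segment x y" "z \<notin> Omega \<epsilon>" using False by blast
    then obtain w where "0 \<le> w" "w \<le> 1" "z = (1 - w) *\<^sub>R x + w *\<^sub>R y"
      by (auto simp: in_segment)
    moreover from this(3) have "z = g w" by (simp add: g_def algebra_simps)
    ultimately show thesis using that[of w] z(2) by simp
  qed
  have h_eq: "h w = (1 - w) * h 0 + w * h 1 + w * (1 - w) * (fst y - fst x)\<^sup>2"
    by (simp add: h_def g_def power2_eq_square algebra_simps)
  have h01: "h 0 \<le> 0" "h 1 \<le> 0" "h 0 + \<epsilon>\<^sup>2 \<ge> 0" "h 1 + \<epsilon>\<^sup>2 \<ge> 0"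
    using x y by (auto simp: h_def g_def Omega_def)
  have "h w + \<epsilon>\<^sup>2 = (1 - w) * (h 0 + \<epsilon>\<^sup>2) + w * (h 1 + \<epsilon>\<^sup>2) + w * (1 - w) * (fst y - fst x)\<^sup>2"
    unfolding h_eq by (simp add: algebra_simps)
  also have "\<dots> \<ge> 0" using h01 w by simp
  finally have hw: "h w > 0" using w(3) by (auto simp: Omega_def h_def)
  have cont: "continuous_on A h" for A unfolding h_def g_def by (intro continuous_intros)
  obtain s where s: "0 \<le> s" "s \<le> w" "h s = 0"
    using IVT'[of h 0 0 w] h01 hw w cont by auto
  obtain t where t: "w \<le> t" "t \<le> 1" "h t = 0"
    using IVT2'[of h 1 0 w] h01 hw w cont by auto
  have "s \<noteq> w" "t \<noteq> w" using s t hw by auto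
  with s t have st: "s < t" by simp
  have "x \<noteq> y" using w(3) x by (auto simp: g_def)
  have dist: "g t - g s = (t - s) *\<^sub>R (y - x)" by (simp add: g_def algebra_simps)
  have param: "g s + c *\<^sub>R (g t - g s) = g (s + c * (t - s))" for c
    unfolding dist by (simp add: g_def algebra_simps)
  have gs: "g s \<in> Gamma_up \<epsilon>" and gt: "g t \<in> Gamma_up \<epsilon>"
    using s t by (auto simp: Gamma_up_def h_def)
  have ne: "g s \<noteq> g t" using dist st \<open>x \<noteq> y\<close> by auto
  \<comment> \<open>The affine change of parameter sends \<open>s\<close> to 0 and \<open>t\<close>
    to 1; the parameters 0 of \<open>x\<close> and 1 of \<open>y\<close> become the coefficients
    below.\<close>
  have xe: "x = g s + (- s / (t - s)) *\<^sub>R (g t - g s)"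
    and ye: "y = g s + ((1 - s) / (t - s)) *\<^sub>R (g t - g s)"
    unfolding param using st by (simp_all add: g_def)
  have "- s / (t - s) \<le> 0" "1 \<le> (1 - s) / (t - s)" using s t st by simp_all
  then show ?thesis using that(2)[OF gs gt ne xe _ ye] by blast
qed (rule that(1))

text \<open>A segment inside the strip is settled by local concavity. Otherwise the intermediate
  point lies beyond \<open>P\<close> or beyond \<open>Q\<close>, and the weight of the far endpoint,
  \<open>1 - \<beta>\<close> or \<open>\<beta>\<close>, is at least \<open>\<alpha>\<close> in both
  cases.\<close>

lemma alpha_concave_of_boundary_conditions:
  assumes "\<epsilon> > 0" and \<alpha>: "0 < \<alpha>" "\<alpha> \<le> 1/2"
    and conc: "locally_concave_on (Omega \<epsilon>) F"
    and nt: "\<forall>x\<in>Gamma_up \<epsilon>. nontangential_derivs_at \<epsilon> F x"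
    and deriv: "\<And>P Q. P \<in> Gamma_up \<epsilon> \<Longrightarrow> Q \<in> Gamma_up \<epsilon> \<Longrightarrow> P \<noteq> Q \<Longrightarrow>
           \<bar>fst P - fst Q\<bar> \<le> (1 - \<alpha>) / sqrt \<alpha> * \<epsilon> \<Longrightarrow>
           dir_deriv \<epsilon> F (Q - P) P \<ge> dir_deriv \<epsilon> F (Q - P) Q"
    and jump: "\<And>P Q. P \<in> Gamma_up \<epsilon> \<Longrightarrow> Q \<in> Gamma_up \<epsilon> \<Longrightarrow> P \<noteq> Q \<Longrightarrow>
           \<bar>fst P - fst Q\<bar> \<le> (1 - \<alpha>) / sqrt \<alpha> * \<epsilon> \<Longrightarrow>
           F P \<ge> (1 - \<alpha>) * F ((1 / (1 - \<alpha>)) *\<^sub>R (P - \<alpha> *\<^sub>R Q)) + \<alpha> * F Q"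
  shows "alpha_concave \<alpha> \<epsilon> F"
  unfolding alpha_concave_def
proof (intro ballI impI)
  fix \<beta> x y
  assume \<beta>: "\<beta> \<in> {\<alpha>..1/2}" and x: "x \<in> Omega \<epsilon>" and y: "y \<in> Omega \<epsilon>"
    and xy: "\<beta> *\<^sub>R x + (1 - \<beta>) *\<^sub>R y \<in> Omega \<epsilon>"
  from \<alpha> have "\<alpha> < 1" by simp
  have across: "F ((1 - u) *\<^sub>R x + u *\<^sub>R y) \<ge> (1 - u) * F x + u * F y"
    if "P \<in> Gamma_up \<epsilon>" "Q \<in> Gamma_up \<epsilon>" "P \<noteq> Q"
      "x = P + a *\<^sub>R (Q - P)" "x \<in> Omega \<epsilon>" "a \<le> 0"
      "y = P + d *\<^sub>R (Q - P)" "y \<in> Omega \<epsilon>" "1 \<le> d"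
      "\<alpha> \<le> u" "u \<le> 1" "(1 - u) * a + u * d \<le> 0" for P Q x y a d u
    by (rule concave_across_secant[OF \<open>\<epsilon> > 0\<close> \<alpha>(1) \<open>\<alpha> < 1\<close> conc nt _ _ that])
      (rule deriv jump; assumption)+
  from x y show "\<beta> * F x + (1 - \<beta>) * F y \<le> F (\<beta> *\<^sub>R x + (1 - \<beta>) *\<^sub>R y)"
  proof (cases rule: segment_in_Omega_or_secant)
    case 1
    then have "concave_on (closed_segment x y) F"
      using conc by (simp add: locally_concave_on_def)
    from concave_onD[OF this, of "1 - \<beta>" x y] show ?thesis using \<beta> \<alpha> by simp
  next
    case (2 P Q a d)
    define t where "t = \<beta> * a + (1 - \<beta>) * d"
    have "\<beta> *\<^sub>R x + (1 - \<beta>) *\<^sub>R y = P + t *\<^sub>R (Q - P)"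
      unfolding 2(4) 2(6) t_def by (simp add: algebra_simps)
    with xy have "0 \<le> (fst P - fst Q)\<^sup>2 * (t * (t - 1))"
      using secant_in_Omega_iff[OF 2(1,2)] by simp
    then have "t \<le> 0 \<or> 1 \<le> t"
      using Gamma_up_fst_neq[OF 2(1-3)] by (auto simp: zero_le_mult_iff)
    then show ?thesis
    proof
      assume "t \<le> 0"
      then show ?thesis
        using across[OF 2(1,2,3,4) x 2(5,6) y 2(7), of "1 - \<beta>"] \<beta> \<alpha> by (simp add: t_def)
    next
      \<comment> \<open>Exchanging \<open>P\<close> with \<open>Q\<close> and \<open>x\<close> with
        \<open>y\<close> replaces each parameter \<open>r\<close> by \<open>1 - r\<close>, which
        reduces this to the previous case with \<open>u = \<beta>\<close>.\<close>
      assume "1 \<le> t"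
      moreover have "x = Q + (1 - a) *\<^sub>R (P - Q)" "y = Q + (1 - d) *\<^sub>R (P - Q)"
        unfolding 2(4) 2(6) by (simp_all add: algebra_simps)
      ultimately show ?thesis
        using across[OF 2(2,1) 2(3)[symmetric] _ y _ _ x, of "1 - d" "1 - a" \<beta>]
          \<beta> \<alpha> 2(5,7) by (simp add: t_def algebra_simps)
    qed
  qed
qed

section \<open>Negation, and the convex case\<close>

lemma has_dir_deriv_minus:
  "has_dir_deriv \<epsilon> F v x d \<Longrightarrow> has_dir_deriv \<epsilon> (\<lambda>z. - F z) v x (- d)"
proof -
  assume "has_dir_deriv \<epsilon> F v x d"
  then have "((\<lambda>t. - ((F (x + t *\<^sub>R v) - F x) / t)) \<longlongrightarrow> - d) (strip_filter \<epsilon> x v)"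
    unfolding has_dir_deriv_def by (rule tendsto_minus)
  moreover have "- ((F (x + t *\<^sub>R v) - F x) / t) = (- F (x + t *\<^sub>R v) - - F x) / t" for t
    unfolding minus_divide_left by simp
  ultimately show ?thesis unfolding has_dir_deriv_def by simp
qed

text \<open>Existence of the limits along the secant is what lets the minus sign pass through
  \<open>Lim\<close>.\<close>

lemma secant_dir_deriv_minus:
  assumes "\<epsilon> > 0" "P \<in> Gamma_up \<epsilon>" "Q \<in> Gamma_up \<epsilon>" "P \<noteq> Q"
    and "\<forall>x\<in>Gamma_up \<epsilon>. nontangential_derivs_at \<epsilon> F x"
  shows "dir_deriv \<epsilon> (\<lambda>z. - F z) (Q - P) P = - dir_deriv \<epsilon> F (Q - P) P"
    and "dir_deriv \<epsilon> (\<lambda>z. - F z) (Q - P) Q = - dir_deriv \<epsilon> F (Q - P) Q"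
proof -
  note d = secant_derivs[OF assms]
  show "dir_deriv \<epsilon> (\<lambda>z. - F z) (Q - P) P = - dir_deriv \<epsilon> F (Q - P) P"
    "dir_deriv \<epsilon> (\<lambda>z. - F z) (Q - P) Q = - dir_deriv \<epsilon> F (Q - P) Q"
    using has_dir_deriv_minus[OF d(1)] has_dir_deriv_minus[OF d(2)]
    unfolding has_dir_deriv_def dir_deriv_def[of _ "\<lambda>z. - F z"] d(3,4)
    by (auto intro!: tendsto_Lim)
qed

theorem lemma2p5:
  fixes \<epsilon> \<alpha> :: real and B b :: "real \<times> real \<Rightarrow> real"
  assumes "\<epsilon> > 0" and "0 < \<alpha>" and "\<alpha> \<le> 1/2"
    and "locally_concave_on (Omega \<epsilon>) B"
    and "locally_convex_on (Omega \<epsilon>) b"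
    and "\<forall>x\<in>Gamma_up \<epsilon>. nontangential_derivs_at \<epsilon> B x \<and> nontangential_derivs_at \<epsilon> b x"
    and "\<And>P Q. P \<in> Gamma_up \<epsilon> \<Longrightarrow> Q \<in> Gamma_up \<epsilon> \<Longrightarrow> P \<noteq> Q \<Longrightarrow>
           \<bar>fst P - fst Q\<bar> \<le> (1 - \<alpha>) / sqrt \<alpha> * \<epsilon> \<Longrightarrow>
           dir_deriv \<epsilon> B (Q - P) P \<ge> dir_deriv \<epsilon> B (Q - P) Q \<and>
           dir_deriv \<epsilon> b (Q - P) P \<le> dir_deriv \<epsilon> b (Q - P) Q"
    and "\<And>P Q S. P \<in> Gamma_up \<epsilon> \<Longrightarrow> Q \<in> Gamma_up \<epsilon> \<Longrightarrow> P \<noteq> Q \<Longrightarrow>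
           \<bar>fst P - fst Q\<bar> \<le> (1 - \<alpha>) / sqrt \<alpha> * \<epsilon> \<Longrightarrow>
           S = (1 / (1 - \<alpha>)) *\<^sub>R (P - \<alpha> *\<^sub>R Q) \<Longrightarrow>
           B P \<ge> (1 - \<alpha>) * B S + \<alpha> * B Q \<and>
           b P \<le> (1 - \<alpha>) * b S + \<alpha> * b Q"
  shows "alpha_concave \<alpha> \<epsilon> B \<and> alpha_convex \<alpha> \<epsilon> b"
proof
  show "alpha_concave \<alpha> \<epsilon> B"
  proof (rule alpha_concave_of_boundary_conditions[OF assms(1-4)])
    show "\<forall>x\<in>Gamma_up \<epsilon>. nontangential_derivs_at \<epsilon> B x" using assms(6) by blast
  qed (use assms(7) assms(8)[OF _ _ _ _ refl] in simp_all)
  have nt: "\<forall>x\<in>Gamma_up \<epsilon>. nontangential_derivs_at \<epsilon> b x" using assms(6) by blast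
  \<comment> \<open>The function \<open>- b\<close> is locally concave, and negation reverses the
    derivative and the jump inequalities for \<open>b\<close>, so the concave case applies to
    it.\<close>
  have conc: "alpha_concave \<alpha> \<epsilon> (\<lambda>z. - b z)"
  proof (rule alpha_concave_of_boundary_conditions[OF assms(1-3)])
    show "locally_concave_on (Omega \<epsilon>) (\<lambda>z. - b z)"
      using assms(5) by (simp add: locally_concave_on_def locally_convex_on_def concave_on_def)
    show "\<forall>x\<in>Gamma_up \<epsilon>. nontangential_derivs_at \<epsilon> (\<lambda>z. - b z) x"
      using nt has_dir_deriv_minus unfolding nontangential_derivs_at_def by blast
  next
    fix P Q
    assume PQ: "P \<in> Gamma_up \<epsilon>" "Q \<in> Gamma_up \<epsilon>" "P \<noteq> Q"
      "\<bar>fst P - fst Q\<bar> \<le> (1 - \<alpha>) / sqrt \<alpha> * \<epsilon>"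
    show "dir_deriv \<epsilon> (\<lambda>z. - b z) (Q - P) P \<ge> dir_deriv \<epsilon> (\<lambda>z. - b z) (Q - P) Q"
      using assms(7)[OF PQ] secant_dir_deriv_minus[OF assms(1) PQ(1-3) nt] by simp
    show "- b P \<ge> (1 - \<alpha>) * - b ((1 / (1 - \<alpha>)) *\<^sub>R (P - \<alpha> *\<^sub>R Q)) + \<alpha> * - b Q"
      using assms(8)[OF PQ refl] by simp
  qed
  show "alpha_convex \<alpha> \<epsilon> b"
    unfolding alpha_convex_def
  proof (intro ballI impI)
    fix \<beta> x y
    assume "\<beta> \<in> {\<alpha>..1/2}" "x \<in> Omega \<epsilon>" "y \<in> Omega \<epsilon>" "\<beta> *\<^sub>R x + (1 - \<beta>) *\<^sub>R y \<in> Omega \<epsilon>"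
    then have "- b (\<beta> *\<^sub>R x + (1 - \<beta>) *\<^sub>R y) \<ge> \<beta> * - b x + (1 - \<beta>) * - b y"
      using conc unfolding alpha_concave_def by blast
    then show "b (\<beta> *\<^sub>R x + (1 - \<beta>) *\<^sub>R y) \<le> \<beta> * b x + (1 - \<beta>) * b y" by simp
  qed
qed

end
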